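(* For $\alpha>0$ and $r\in\mathbb{R}$, let $x\mapsto f_\alpha(r,x)$ be the even extension to $\mathbb{R}$ of the function $x\mapsto r+x^\alpha$, $x\geq 0$ (that is, $f_\alpha(r,x)=r+|x|^\alpha$). Consider the two-parameter family of differential equations $$\dot{x}=f_\alpha(r,x),\qquad x\in\mathbb{R},\ r\in\mathbb{R}.$$ Let $t(r)$ be the time a trajectory spends in $[-1,1]$ for $r>0$. Then, as $r\to 0^+$: - for every fixed $\alpha\in(0,1)$, $t(r)=O(1)$; - for every fixed $\alpha\in[1,\infty)$, $t(r)\to\infty$.
   Context: Scaling law: for $r>0$, $t(r)$ denotes the time a trajectory of $\dot{x}=f_\alpha(r,x)$ spends in the interval $[-1,1]$, passing from $x=-1$ to $x=1$, i.e. $t(r)=\int_{-1}^{1}\frac{dx}{f_\alpha(r,x)}$. The scaling law is the asymptotic behaviour of $t(r)$ as $r\to 0^+$. *)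

theory Defs
  imports "HOL-Analysis.Analysis" "HOL-Library.Landau_Symbols"
begin

text \<open>Meant for \<open>\<alpha> > 0\<close>; then \<open>0 powr \<alpha> = 0\<close> is the right value at the origin.\<close>

definition f_alpha :: "real \<Rightarrow> real \<Rightarrow> real \<Rightarrow> real" where
  "f_alpha \<alpha> r x = r + \<bar>x\<bar> powr \<alpha>"

text \<open>A passage is the part of a trajectory lying over \<open>[-1,1]\<close>. The equation is autonomous, so
  time may be shifted to make the trajectory enter at time \<open>0\<close>; at the two end points of the time
  interval the derivative is one-sided.\<close>

definition passage :: "real \<Rightarrow> real \<Rightarrow> (real \<Rightarrow> real) \<Rightarrow> real \<Rightarrow> bool" where
  "passage \<alpha> r x T \<longleftrightarrow> 0 \<le> T \<and> x 0 = -1 \<and> x T = 1 \<and>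
     (\<forall>s\<in>{0..T}. (x has_real_derivative f_alpha \<alpha> r (x s)) (at s within {0..T}))"

text \<open>Well-defined for \<open>\<alpha> > 0\<close> and \<open>r > 0\<close>, see \<open>passage_unique\<close> and
  \<open>passage_exists\<close> below; no value is intended for other parameters.\<close>

definition transit_time :: "real \<Rightarrow> real \<Rightarrow> real" where
  "transit_time \<alpha> r = (THE T. \<exists>x. passage \<alpha> r x T)"

lemma f_alpha_pos: "0 < r \<Longrightarrow> 0 < f_alpha \<alpha> r x"
  by (simp add: f_alpha_def add_pos_nonneg)

lemma continuous_on_f_alpha: "0 < \<alpha> \<Longrightarrow> continuous_on S (f_alpha \<alpha> r)"
  unfolding f_alpha_def by (intro continuous_on_add continuous_on_powr' continuous_intros) auto

lemma passage_in_interval: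
  assumes "0 < r" "passage \<alpha> r x T" "s \<in> {0..T}"
  shows "x s \<in> {-1..1}"
proof -
  have mono: "x u \<le> x v" if uv: "0 \<le> u" "u \<le> v" "v \<le> T" for u v
  proof -
    have "((\<lambda>s. f_alpha \<alpha> r (x s)) has_integral (x v - x u)) {u..v}"
    proof (rule fundamental_theorem_of_calculus[OF uv(2)])
      fix z assume z: "z \<in> {u..v}"
      hence "(x has_real_derivative f_alpha \<alpha> r (x z)) (at z within {0..T})"
        using assms(2) uv by (auto simp: passage_def)
      hence "(x has_real_derivative f_alpha \<alpha> r (x z)) (at z within {u..v})"
        by (rule has_field_derivative_subset) (use uv in auto)
      thus "(x has_vector_derivative f_alpha \<alpha> r (x z)) (at z within {u..v})"
        by (simp add: has_real_derivative_iff_has_vector_derivative)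
    qed
    hence "0 \<le> x v - x u"
      by (rule has_integral_nonneg) (simp add: f_alpha_pos[OF assms(1)] less_imp_le)
    thus ?thesis by simp
  qed
  show ?thesis using mono[of 0 s] mono[of s T] assms(2,3) by (auto simp: passage_def)
qed

lemma f_alpha_antiderivative:
  assumes "0 < \<alpha>" "0 < r"
  shows "\<exists>G. (\<forall>x\<in>{-2..2}. (G has_real_derivative 1 / f_alpha \<alpha> r x) (at x within {-2..2})) \<and>
    (\<forall>x\<in>{-2<..<2}. (G has_real_derivative 1 / f_alpha \<alpha> r x) (at x))"
proof -
  let ?G = "\<lambda>x. integral {-2..x} (\<lambda>x. 1 / f_alpha \<alpha> r x)"
  have c: "continuous_on {-2..2} (\<lambda>x. 1 / f_alpha \<alpha> r x)"
    using f_alpha_pos[OF assms(2)] by (intro continuous_intros continuous_on_f_alpha assms) (metis less_irrefl)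
  have 1: "(?G has_real_derivative 1 / f_alpha \<alpha> r x) (at x within {-2..2})" if "x \<in> {-2..2}" for x
    using integral_has_real_derivative[OF c that] .
  have 2: "(?G has_real_derivative 1 / f_alpha \<alpha> r x) (at x)" if "x \<in> {-2<..<2}" for x
    using 1[of x] that at_within_Icc_at[of "-2" x 2] by auto
  show ?thesis using 1 2 by (intro exI[of _ ?G] conjI ballI)
qed

lemma passage_time_eq:
  assumes "0 < \<alpha>" "0 < r" and p: "passage \<alpha> r x T"
    and G: "\<And>x. x \<in> {-2<..<2} \<Longrightarrow> (G has_real_derivative 1 / f_alpha \<alpha> r x) (at x)"
  shows "T = G 1 - G (-1)"
proof -
  have d: "((\<lambda>s. G (x s)) has_real_derivative 1) (at s within {0..T})" if "s \<in> {0..T}" for s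
  proof -
    have "x s \<in> {-2<..<2}" using passage_in_interval[OF assms(2) p that] by auto
    moreover have "(x has_real_derivative f_alpha \<alpha> r (x s)) (at s within {0..T})"
      using p that by (simp add: passage_def)
    ultimately have "((\<lambda>s. G (x s)) has_real_derivative 1 / f_alpha \<alpha> r (x s) * f_alpha \<alpha> r (x s))
        (at s within {0..T})"
      by (intro DERIV_chain2[where f = G and g = x] G)
    thus ?thesis using f_alpha_pos[OF assms(2), of \<alpha> "x s"] by simp
  qed
  have T: "0 \<le> T" using p by (simp add: passage_def)
  have "((\<lambda>_. 1) has_integral (G (x T) - G (x 0))) {0..T}"
    using d T by (intro fundamental_theorem_of_calculus)
      (auto simp: has_real_derivative_iff_has_vector_derivative)
  moreover have "((\<lambda>_. 1) has_integral (1 * (T - 0))) {0..T}"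
    using has_integral_const_real[of "1::real" 0 T] T by simp
  ultimately have "G (x T) - G (x 0) = 1 * (T - 0)"
    by (rule has_integral_unique)
  with p show ?thesis by (simp add: passage_def)
qed

lemma passage_unique:
  assumes "0 < \<alpha>" "0 < r" "passage \<alpha> r x T" "passage \<alpha> r y U"
  shows "T = U"
proof -
  obtain G where G: "\<And>x. x \<in> {-2<..<2} \<Longrightarrow> (G has_real_derivative 1 / f_alpha \<alpha> r x) (at x)"
    using f_alpha_antiderivative[OF assms(1,2)] by blast
  show ?thesis
    using passage_time_eq[OF assms(1-3) G] passage_time_eq[OF assms(1,2,4) G] by simp
qed

lemma passage_exists:
  assumes "0 < \<alpha>" "0 < r"
  shows "\<exists>x T. passage \<alpha> r x T"
proof -
  obtain G where G1: "\<And>x. x \<in> {-2..2} \<Longrightarrow> (G has_real_derivative 1 / f_alpha \<alpha> r x) (at x within {-2..2})"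
    and G: "\<And>x. x \<in> {-2<..<2} \<Longrightarrow> (G has_real_derivative 1 / f_alpha \<alpha> r x) (at x)"
    using f_alpha_antiderivative[OF assms] by blast
  have cG: "continuous_on {-2..2} G"
    using DERIV_continuous[OF G1] by (auto simp: continuous_on_eq_continuous_within)
  have sm: "G u < G v" if "-2 \<le> u" "u < v" "v \<le> 2" for u v
  proof (rule DERIV_pos_imp_increasing_open[OF \<open>u < v\<close>])
    show "\<exists>y. (G has_real_derivative y) (at z) \<and> 0 < y" if "u < z" "z < v" for z
      using G[of z] f_alpha_pos[OF assms(2)] that \<open>-2 \<le> u\<close> \<open>v \<le> 2\<close> by (intro exI[of _ "1 / f_alpha \<alpha> r z"]) auto
    show "continuous_on {u..v} G"
      using cG that by (auto intro: continuous_on_subset)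
  qed
  have inj: "inj_on G {-2..2}"
  proof (rule inj_onI)
    fix u v assume "u \<in> {-2..2}" "v \<in> {-2..2}" "G u = G v"
    thus "u = v" using sm[of u v] sm[of v u] by (cases u v rule: linorder_cases) auto
  qed
  define g where "g = the_inv_into {-2..2} G"
  have gG: "g (G z) = z" if "z \<in> {-2..2}" for z
    unfolding g_def using inj that by (rule the_inv_into_f_f)
  have cg: "continuous_on (G ` {-2..2}) g"
    by (rule continuous_on_inv[OF cG]) (auto simp: gG)
  have img: "y \<in> G ` {-2..2}" if "y \<in> {G (-2)..G 2}" for y
    using IVT'[of G "-2" y 2] that cG by auto
  have gr: "G (g y) = y" if "y \<in> {G (-2)..G 2}" for y
    using img[OF that] gG by auto
  have gd: "(g has_real_derivative f_alpha \<alpha> r (g y)) (at y)" if y: "y \<in> {G (-2)<..<G 2}" for y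
  proof -
    have "continuous_on {G (-2)<..<G 2} g"
      using cg by (rule continuous_on_subset) (auto intro!: img)
    hence ic: "isCont g y" using y by (simp add: continuous_on_eq_continuous_at)
    obtain z where z: "z \<in> {-2..2}" "y = G z" using img[of y] y by auto
    have gz: "g y = z" using gG z by auto
    have "z \<noteq> -2" "z \<noteq> 2" using z y by auto
    hence "z \<in> {-2<..<2}" using z by auto
    from G[OF this] have "(G has_real_derivative 1 / f_alpha \<alpha> r (g y)) (at (g y))" by (simp add: gz)
    hence "(g has_real_derivative inverse (1 / f_alpha \<alpha> r (g y))) (at y)"
      by (rule DERIV_inverse_function[where a = "G (-2)" and b = "G 2"])
        (use f_alpha_pos[OF assms(2), of \<alpha> "g y"] gr ic y in simp_all)
    thus ?thesis by simp
  qed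
  have o: "G (-2) < G (-1)" "G (-1) < G 1" "G 1 < G 2" using sm by auto
  have "passage \<alpha> r (\<lambda>s. g (s + G (-1))) (G 1 - G (-1))"
    unfolding passage_def
  proof (intro conjI ballI)
    fix s assume s: "s \<in> {0..G 1 - G (-1)}"
    have "(g has_real_derivative f_alpha \<alpha> r (g (s + G (-1)))) (at (s + G (-1)))"
      using s o by (intro gd) auto
    hence "((\<lambda>s. g (s + G (-1))) has_real_derivative f_alpha \<alpha> r (g (s + G (-1)))) (at s)"
      by (simp add: DERIV_shift add.commute)
    thus "((\<lambda>s. g (s + G (-1))) has_real_derivative f_alpha \<alpha> r (g (s + G (-1))))
        (at s within {0..G 1 - G (-1)})" by (rule has_field_derivative_at_within)
  qed (use o gG in auto)
  thus ?thesis by blast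
qed

lemma transit_time_eq_integral:
  assumes "0 < \<alpha>" "0 < r"
  shows "transit_time \<alpha> r = integral {-1..1} (\<lambda>x. 1 / f_alpha \<alpha> r x)"
proof -
  obtain x T where p: "passage \<alpha> r x T" using passage_exists[OF assms] by blast
  obtain G where G: "\<And>x. x \<in> {-2<..<2} \<Longrightarrow> (G has_real_derivative 1 / f_alpha \<alpha> r x) (at x)"
    using f_alpha_antiderivative[OF assms] by blast
  have "transit_time \<alpha> r = T"
    unfolding transit_time_def
  proof (rule the_equality)
    show "\<exists>x. passage \<alpha> r x T" using p by (intro exI[of _ x])
    show "U = T" if "\<exists>y. passage \<alpha> r y U" for U
      using that passage_unique[OF assms _ p] by (elim exE)
  qed
  also have "T = G 1 - G (-1)" by (rule passage_time_eq[OF assms p G])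
  finally have t: "transit_time \<alpha> r = G 1 - G (-1)" .
  have "((\<lambda>x. 1 / f_alpha \<alpha> r x) has_integral (G 1 - G (-1))) {-1..1}"
  proof (rule fundamental_theorem_of_calculus)
    fix z :: real assume "z \<in> {-1..1}"
    hence "(G has_real_derivative 1 / f_alpha \<alpha> r z) (at z within {-1..1})"
      by (intro has_field_derivative_at_within[OF G]) auto
    thus "(G has_vector_derivative 1 / f_alpha \<alpha> r z) (at z within {-1..1})"
      by (simp add: has_real_derivative_iff_has_vector_derivative)
  qed simp
  thus ?thesis by (simp add: t integral_unique)
qed

end

theory Submission
  imports Defs "HOL-Real_Asymp.Real_Asymp"
begin

text \<open>By symmetry the transit time is twice the integral of \<open>1 / (r + x\<^sup>\<alpha>)\<close> over \<open>[0,1]\<close>.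
  For \<open>\<alpha> < 1\<close> the integrand is dominated, uniformly in \<open>r\<close>, by the integrable \<open>x\<^sup>-\<^sup>\<alpha>\<close>. For
  \<open>\<alpha> \<ge> 1\<close> we have \<open>x\<^sup>\<alpha> \<le> x\<close> on \<open>[0,1]\<close>, so the integral is at least that of
  \<open>1 / (r + x)\<close>, namely \<open>ln ((r + 1) / r)\<close>.\<close>

lemma integrable_inverse_f_alpha:
  assumes "0 < \<alpha>" "0 < r"
  shows "(\<lambda>x. 1 / f_alpha \<alpha> r x) integrable_on {a..b}"
proof (rule integrable_continuous_real)
  show "continuous_on {a..b} (\<lambda>x. 1 / f_alpha \<alpha> r x)"
    using f_alpha_pos[OF assms(2)]
    by (intro continuous_intros continuous_on_f_alpha assms) (metis less_irrefl)
qed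

lemma transit_time_eq_twice_integral:
  assumes "0 < \<alpha>" "0 < r"
  shows "transit_time \<alpha> r = 2 * integral {0..1} (\<lambda>x. 1 / f_alpha \<alpha> r x)"
proof -
  let ?h = "\<lambda>x. 1 / f_alpha \<alpha> r x"
  \<comment> \<open>Reflection \<open>x \<mapsto> - x\<close> swaps the two halves, and
    \<open>f_alpha\<close> sees only the absolute value of \<open>x\<close>.\<close>
  have "integral {-1..0} ?h = integral {0..1} ?h"
    using Henstock_Kurzweil_Integration.integral_reflect_real[of 1 0 ?h]
    by (simp add: f_alpha_def)
  moreover have "integral {-1..0} ?h + integral {0..1} ?h = integral {-1..1} ?h"
    by (rule Henstock_Kurzweil_Integration.integral_combine)
      (simp_all add: integrable_inverse_f_alpha[OF assms])
  ultimately show ?thesis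
    by (simp add: transit_time_eq_integral[OF assms])
qed

text \<open>The constant is twice the integral of \<open>x powr - \<alpha>\<close> over
  \<open>{0..1}\<close>, finite because \<open>\<alpha> < 1\<close>; its independence of
  \<open>r\<close> is what gives boundedness.\<close>

lemma transit_time_le:
  assumes "0 < \<alpha>" "\<alpha> < 1" "0 < r"
  shows "transit_time \<alpha> r \<le> 2 / (1 - \<alpha>)"
proof -
  let ?h = "\<lambda>x. 1 / f_alpha \<alpha> r x"
  \<comment> \<open>At \<open>0\<close> the function \<open>x powr - \<alpha>\<close> has the junk value \<open>0\<close>, so the bound is patched there.\<close>
  let ?g = "\<lambda>x. if x = 0 then 1 / r else x powr - \<alpha>"
  have "((\<lambda>x. x powr - \<alpha>) has_integral 1 / (1 - \<alpha>)) {0..1}"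
    using has_integral_powr_from_0[of "- \<alpha>" 1] assms by (simp add: algebra_simps)
  hence "(?g has_integral 1 / (1 - \<alpha>)) {0..1}"
    by (rule has_integral_spike_finite[of "{0}", rotated 2]) auto
  moreover have "(?h has_integral integral {0..1} ?h) {0..1}"
    using assms by (intro integrable_integral integrable_inverse_f_alpha)
  \<comment> \<open>At \<open>x = 0\<close> both sides equal \<open>1 / r\<close>, since
    \<open>0 powr \<alpha> = 0\<close>; elsewhere \<open>r\<close> is dropped from the
    denominator.\<close>
  moreover have "?h x \<le> ?g x" if "x \<in> {0..1}" for x
    using that assms by (auto simp: f_alpha_def powr_minus_divide intro!: divide_left_mono mult_pos_pos add_pos_nonneg)
  ultimately have "integral {0..1} ?h \<le> 1 / (1 - \<alpha>)"
    by (blast intro: has_integral_le)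
  thus ?thesis
    by (simp add: transit_time_eq_twice_integral assms)
qed

text \<open>The bound is the exact transit time for the borderline exponent
  \<open>\<alpha> = 1\<close>: larger exponents lower \<open>f_alpha\<close> on
  \<open>{-1..1}\<close> and so slow the passage.\<close>

lemma transit_time_ge:
  assumes "1 \<le> \<alpha>" "0 < r"
  shows "2 * ln ((r + 1) / r) \<le> transit_time \<alpha> r"
proof -
  \<comment> \<open>The antiderivative is \<open>ln (r + x)\<close>; writing \<open>r + 0\<close>
    keeps its value at the left end point in that shape for unification.\<close>
  have "((\<lambda>x. 1 / (r + x)) has_integral ln (r + 1) - ln (r + 0)) {0..1}"
    using assms(2)
    by (intro fundamental_theorem_of_calculus)
      (auto intro!: derivative_eq_intros simp flip: has_real_derivative_iff_has_vector_derivative)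
  moreover have "((\<lambda>x. 1 / f_alpha \<alpha> r x) has_integral
      integral {0..1} (\<lambda>x. 1 / f_alpha \<alpha> r x)) {0..1}"
    using assms by (intro integrable_integral integrable_inverse_f_alpha) auto
  moreover have "1 / (r + x) \<le> 1 / f_alpha \<alpha> r x" if "x \<in> {0..1}" for x
  proof -
    have "x powr \<alpha> \<le> x"
      using powr_mono'[of 1 \<alpha> x] that assms by simp
    thus ?thesis
      using that assms f_alpha_pos[of r \<alpha> x] by (intro divide_left_mono) (auto simp: f_alpha_def)
  qed
  ultimately have "ln (r + 1) - ln (r + 0) \<le> integral {0..1} (\<lambda>x. 1 / f_alpha \<alpha> r x)"
    by (rule has_integral_le)
  thus ?thesis
    using assms by (simp add: transit_time_eq_twice_integral ln_div)
qed

theorem theorem3p2: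
  shows "(\<forall>\<alpha>\<in>{0<..<1}. transit_time \<alpha> \<in> O[at_right 0](\<lambda>_. 1)) \<and>
         (\<forall>\<alpha>\<in>{1..}. filterlim (transit_time \<alpha>) at_top (at_right 0))"
proof (intro conjI ballI)
  fix \<alpha> :: real assume \<alpha>: "\<alpha> \<in> {0<..<1}"
  have "norm (transit_time \<alpha> r) \<le> 2 / (1 - \<alpha>) * norm (1 :: real)" if "0 < r" for r
  proof -
    have "0 \<le> transit_time \<alpha> r"
      using \<alpha> that f_alpha_pos[OF that, THEN less_imp_le]
      by (simp add: transit_time_eq_integral integral_nonneg integrable_inverse_f_alpha)
    with transit_time_le[of \<alpha> r] \<alpha> that show ?thesis by simp
  qed
  \<comment> \<open>The bound holds for every positive \<open>r\<close>, so the window from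
    \<open>0\<close> to \<open>1\<close> is an arbitrary choice.\<close>
  thus "transit_time \<alpha> \<in> O[at_right 0](\<lambda>_. 1)"
    by (intro bigoI eventually_at_rightI[of 0 1]) auto
next
  fix \<alpha> :: real assume \<alpha>: "\<alpha> \<in> {1..}"
  \<comment> \<open>Near \<open>0\<close> this grows like \<open>2 * ln (1 / r)\<close>.\<close>
  have "filterlim (\<lambda>r :: real. 2 * ln ((r + 1) / r)) at_top (at_right 0)"
    by real_asymp
  moreover have "\<forall>\<^sub>F r in at_right 0. 2 * ln ((r + 1) / r) \<le> transit_time \<alpha> r"
    using \<alpha> by (intro eventually_at_rightI[of 0 1] transit_time_ge) auto
  ultimately show "filterlim (transit_time \<alpha>) at_top (at_right 0)"
    by (rule filterlim_at_top_mono)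
qed

end
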